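(* Let $\delta = b(b-1)/2$, with $b$ a positive integer, be a triangular number such that $\delta \equiv 3 \pmod{4}$. Then the equation $x - y = \delta$ has only finitely many solutions $(x,y)$ with $x$ and $y$ both perfect numbers.
   Context: A positive integer $n$ is perfect if $\sigma(n) = 2n$, where $\sigma(n)$ denotes the sum of all positive divisors of $n$. *)

theory Defs
  imports "HOL-Number_Theory.Number_Theory"
begin

definition divisor_sum :: "nat \<Rightarrow> nat" where
  "divisor_sum n = (\<Sum>d | d dvd n. d)"

(* Positivity matters: the divisors of 0 form an infinite set, whose sum is 0 in HOL,
   so 0 would satisfy the equation. *)
definition perfect :: "nat \<Rightarrow> bool" where
  "perfect n \<longleftrightarrow> n > 0 \<and> divisor_sum n = 2 * n"

end

theory Submission
  imports Defs "HOL-Analysis.Generalised_Binomial_Theorem"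
    "HOL-Computational_Algebra.Formal_Power_Series" "HOL-Computational_Algebra.Squarefree"
begin

text \<open>By the theorems of Euclid--Euler and Euler, an even perfect number is
  \<open>x = 2 ^ e * (2 ^ (e + 1) - 1)\<close>, and an odd one is a prime times a square and is congruent
  to 1 modulo 4. Since \<open>\<delta>\<close> is 3 modulo 4, either \<open>y = 6\<close> or \<open>x\<close> is even and
  \<open>y\<close> is odd. As \<open>\<delta> = c (2 c - 1)\<close> is triangular,
  \<open>y = x - \<delta>\<close> factors as \<open>(2 ^ e - c) * (2 ^ (e + 1) + 2 c - 1)\<close>, where the gcd of the
  factors divides \<open>4 c - 1\<close>. Hence one of the factors is \<open>d * w ^ 2\<close> with
  \<open>d\<close> dividing \<open>4 c - 1\<close>, which leaves finitely many equations
  \<open>d * w ^ 2 = 2 ^ n + k\<close> with \<open>k \<noteq> 0\<close>. Each has finitely many solutions by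
  Beukers' hypergeometric method: a large solution \<open>(w0, n0)\<close> expresses \<open>sqrt d\<close> through
  \<open>sqrt (1 + k / 2 ^ n0)\<close>, and Pade approximants to the square root, evaluated at
  \<open>k / 2 ^ n0\<close>, approximate it by rationals too well for a second solution
  with \<open>n\<close> of the same parity and \<open>n \<ge> 20 n0\<close> to exist.\<close>

section \<open>Half-integer binomial coefficients\<close>

text \<open>Vandermonde with \<open>N - j = (i - j) + (N - i)\<close> expands the middle factor in
  the \<open>(i - j) choose l\<close>. Trinomial revision absorbs each of these into
  \<open>b\<close>, and a second Vandermonde leaves \<open>(p - l) choose (i - l)\<close>, which is
  0 as \<open>p < i\<close>.\<close>

lemma pade_coeff_vanish:
  fixes a b :: "'a::field_char_0"
  assumes "a + b = of_nat p" "p < i" "i \<le> N"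
  shows "(\<Sum>j\<le>i. (a gchoose j) * of_nat ((N - j) choose p) * (b gchoose (i - j))) = 0"
proof -
  have inner: "(\<Sum>j\<le>i. (a gchoose j) * (b gchoose (i - j)) * of_nat ((i - j) choose l)) = 0" if "l \<le> p" for l
  proof -
    have "(\<Sum>j\<le>i. (a gchoose j) * (b gchoose (i - j)) * of_nat ((i - j) choose l))
        = (\<Sum>j\<le>i - l. (a gchoose j) * (b gchoose (i - j)) * of_nat ((i - j) choose l))"
      using that assms by (intro sum.mono_neutral_right) (auto simp: binomial_eq_0)
    also have "\<dots> = (\<Sum>j\<le>i - l. (b gchoose l) * ((a gchoose j) * ((b - of_nat l) gchoose (i - l - j))))"
    proof (intro sum.cong refl)
      fix j assume "j \<in> {..i - l}"
      then have "l \<le> i - j" using that assms by auto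
      from gbinomial_trinomial_revision[OF this, of b]
      show "(a gchoose j) * (b gchoose (i - j)) * of_nat ((i - j) choose l) =
            (b gchoose l) * ((a gchoose j) * ((b - of_nat l) gchoose (i - l - j)))"
        by (simp add: binomial_gbinomial mult_ac add.commute[of l j])
    qed
    also have "\<dots> = (b gchoose l) * ((a + (b - of_nat l)) gchoose (i - l))"
      using gbinomial_Vandermonde[of a "b - of_nat l" "i - l"]
      by (simp only: sum_distrib_left[symmetric] atLeast0AtMost)
    also have "a + (b - of_nat l) = of_nat (p - l)"
      using assms(1) that by (simp add: of_nat_diff algebra_simps)
    also have "(of_nat (p - l) gchoose (i - l) :: 'a) = 0"
      unfolding binomial_gbinomial[symmetric] using assms that by (simp add: binomial_eq_0)
    finally show ?thesis by simp
  qed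
  have "(\<Sum>j\<le>i. (a gchoose j) * of_nat ((N - j) choose p) * (b gchoose (i - j)))
      = (\<Sum>j\<le>i. \<Sum>l\<le>p. of_nat ((N - i) choose (p - l)) *
           ((a gchoose j) * (b gchoose (i - j)) * of_nat ((i - j) choose l)))"
  proof (intro sum.cong refl)
    fix j assume "j \<in> {..i}"
    then have "N - j = (i - j) + (N - i)" using assms by auto
    then have "(N - j) choose p = (\<Sum>l\<le>p. ((i - j) choose l) * ((N - i) choose (p - l)))"
      by (simp add: vandermonde)
    then show "(a gchoose j) * of_nat ((N - j) choose p) * (b gchoose (i - j)) =
      (\<Sum>l\<le>p. of_nat ((N - i) choose (p - l)) *
           ((a gchoose j) * (b gchoose (i - j)) * of_nat ((i - j) choose l)))"
      by (simp add: sum_distrib_left sum_distrib_right mult_ac)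
  qed
  also have "\<dots> = (\<Sum>l\<le>p. of_nat ((N - i) choose (p - l)) *
      (\<Sum>j\<le>i. (a gchoose j) * (b gchoose (i - j)) * of_nat ((i - j) choose l)))"
    by (subst sum.swap) (simp add: sum_distrib_left)
  also have "\<dots> = 0" by (simp add: inner)
  finally show ?thesis .
qed

lemma gbinomial_Suc_mult:
  fixes a :: "'a::field_char_0"
  shows "(a gchoose Suc j) * of_nat (Suc j) = (a - of_nat j) * (a gchoose j)"
  using gbinomial_mult_1[of a j] by (simp add: algebra_simps)

text \<open>Both sides start at 1 and satisfy the same first-order recurrence in \<open>j\<close>.
  The link to central binomial coefficients is the source of the denominator bound
  \<open>4 ^ j\<close>.\<close>

lemma gbinomial_minus_half:
  "(-4) ^ j * ((-1/2 :: real) gchoose j) = real ((2 * j) choose j)"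
proof (induction j)
  case (Suc j)
  have c: "(2 * Suc j choose Suc j) * Suc j = 2 * (2 * j + 1) * (2 * j choose j)"
  proof -
    have "Suc j * (Suc (Suc (2 * j)) choose Suc j) = Suc (Suc (2 * j)) * (Suc (2 * j) choose j)"
      using Suc_times_binomial_eq[of "Suc (2 * j)" j] by (simp only: mult.commute)
    moreover have "Suc j * (Suc (2 * j) choose j) = Suc (2 * j) * (2 * j choose j)"
    proof -
      have "Suc (2 * j) choose j = Suc (2 * j) choose Suc j"
        by (subst binomial_symmetric) auto
      then show ?thesis
        using Suc_times_binomial_eq[of "2 * j" j] by (simp add: mult.commute)
    qed
    ultimately show ?thesis
      by (metis (no_types, lifting) Suc_1 Suc_eq_plus1 add_Suc_right mult.assoc mult.commute mult_Suc_right mult_cancel_left nat.distinct(1) add_2_eq_Suc)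
  qed
  have "(-4) ^ Suc j * ((-1/2 :: real) gchoose Suc j) * real (Suc j)
     = -4 * ((-4) ^ j * ((-1/2) gchoose j)) * (-1/2 - real j)"
    using gbinomial_Suc_mult[of "-1/2::real" j] by (simp add: mult_ac)
  also have "\<dots> = real (2 * (2 * j + 1) * (2 * j choose j))"
    unfolding Suc by (simp add: algebra_simps)
  also have "\<dots> = real (2 * Suc j choose Suc j) * real (Suc j)"
    by (metis c of_nat_mult)
  finally show ?case by (subst (asm) mult_cancel_right) simp
qed auto

text \<open>Vandermonde for \<open>m + (-1/2)\<close> reduces this to \<open>m = 0\<close>, where
  central binomial coefficients give integrality.\<close>

lemma power4_gbinomial_half_Ints:
  "4 ^ j * ((real m - 1/2) gchoose j) \<in> \<int>"
proof -
  have base: "4 ^ j * ((-1/2 :: real) gchoose j) \<in> \<int>" for j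
  proof -
    have "4 ^ j * ((-1/2 :: real) gchoose j) = (-1) ^ j * ((-4) ^ j * ((-1/2) gchoose j))"
      by (simp flip: mult.assoc power_mult_distrib)
    then show ?thesis unfolding gbinomial_minus_half by simp
  qed
  have "4 ^ j * ((real m - 1/2) gchoose j)
     = (\<Sum>i=0..j. of_nat (m choose i) * 4 ^ i * (4 ^ (j - i) * ((-1/2) gchoose (j - i))))"
    using gbinomial_Vandermonde[of "real m" "-1/2" j, symmetric]
    by (simp add: sum_distrib_left binomial_gbinomial power_add[symmetric] mult_ac
          flip: power_add cong: sum.cong_simp)
       (auto intro!: sum.cong simp flip: power_add)
  also have "\<dots> \<in> \<int>" by (intro Ints_sum Ints_mult base) auto
  finally show ?thesis .
qed

text \<open>Factor by factor the product is dominated by that of \<open>(m + j) choose j\<close>,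
  because \<open>\<bar>m - 1/2 - j\<bar> \<le> m + j + 1\<close>.\<close>

lemma abs_gbinomial_half_le:
  "\<bar>(real m - 1/2) gchoose j\<bar> \<le> 2 ^ (m + j)"
proof -
  have "\<bar>(real m - 1/2) gchoose j\<bar> \<le> real ((m + j) choose j)"
  proof (induction j)
    case (Suc j)
    have "\<bar>(real m - 1/2) gchoose Suc j\<bar> * real (Suc j)
        = \<bar>real m - 1/2 - real j\<bar> * \<bar>(real m - 1/2) gchoose j\<bar>"
      using arg_cong[OF gbinomial_Suc_mult[of "real m - 1/2" j], of abs] by (simp add: abs_mult)
    also have "\<dots> \<le> real (m + Suc j) * real ((m + j) choose j)"
      using Suc by (intro mult_mono) auto
    also have "\<dots> = real ((m + Suc j) choose Suc j) * real (Suc j)"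
      using Suc_times_binomial_eq[of "m + j" j] by (metis add_Suc_right of_nat_mult)
    finally show ?case by (simp del: of_nat_Suc)
  qed auto
  also have "\<dots> \<le> real (2 ^ (m + j))"
    using binomial_le_pow2[of "m + j" j] by (rule of_nat_mono)
  finally show ?thesis by simp
qed

lemma abs_gbinomial_le_1:
  fixes a :: real
  assumes "-1 \<le> a" "a \<le> 1"
  shows "\<bar>a gchoose j\<bar> \<le> 1"
proof (induction j)
  case (Suc j)
  have "\<bar>a gchoose Suc j\<bar> * real (Suc j) = \<bar>a - real j\<bar> * \<bar>a gchoose j\<bar>"
    using arg_cong[OF gbinomial_Suc_mult[of a j], of abs] by (simp add: abs_mult)
  also have "\<dots> \<le> real (Suc j) * 1"
    using Suc assms by (intro mult_mono) auto
  finally show ?case by (simp del: of_nat_Suc)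
qed auto

section \<open>Pade approximants to the square root\<close>

text \<open>The binomial series of \<open>(1 + c t) powr a\<close> in the formal variable
  \<open>t\<close>.\<close>

definition fps_binom_scaled :: "real \<Rightarrow> real \<Rightarrow> real fps" where
  "fps_binom_scaled a c = Abs_fps (\<lambda>n. (a gchoose n) * c ^ n)"

lemma fps_binom_scaled_mult:
  "fps_binom_scaled a c * fps_binom_scaled b c = fps_binom_scaled (a + b) c"
proof (rule fps_ext)
  fix n
  have "fps_nth (fps_binom_scaled a c * fps_binom_scaled b c) n
      = (\<Sum>i=0..n. c ^ n * ((a gchoose i) * (b gchoose (n - i))))"
    by (auto simp: fps_binom_scaled_def fps_mult_nth mult_ac simp flip: power_add intro!: sum.cong)
  also have "\<dots> = fps_nth (fps_binom_scaled (a + b) c) n"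
    by (simp add: fps_binom_scaled_def gbinomial_Vandermonde flip: sum_distrib_left)
  finally show "fps_nth (fps_binom_scaled a c * fps_binom_scaled b c) n
    = fps_nth (fps_binom_scaled (a + b) c) n" .
qed

lemma fps_binom_scaled_power:
  "fps_binom_scaled a c ^ n = fps_binom_scaled (real n * a) c"
proof (induction n)
  case 0
  show ?case by (rule fps_ext) (auto simp: fps_binom_scaled_def gbinomial_0_left)
qed (simp add: fps_binom_scaled_mult algebra_simps)

text \<open>These are the coefficients of \<open>1 / (1 - t) ^ (m + 1)\<close>.\<close>

lemma gbinomial_minus_Suc:
  "(-(real m + 1) gchoose n) * (-1) ^ n = real ((m + n) choose m)"
proof -
  have "(-(real m + 1) gchoose n) * (-1) ^ n = (real m + 1 + real n - 1) gchoose n"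
    by (subst gbinomial_minus) (simp add: mult_ac flip: power_mult_distrib)
  also have "\<dots> = real ((m + n) choose n)"
    by (simp add: binomial_gbinomial)
  also have "(m + n) choose n = (m + n) choose m"
    by (subst binomial_symmetric) auto
  finally show ?thesis .
qed

lemma fps_nonneg_power:
  fixes f :: "real fps"
  assumes "\<And>n. fps_nth f n \<ge> 0"
  shows "fps_nth (f ^ m) n \<ge> 0"
  using assms by (induction m arbitrary: n) (auto simp: fps_mult_nth intro!: sum_nonneg mult_nonneg_nonneg)

text \<open>Beyond index 0 the coefficients of \<open>(1 + t) powr (-1/2)\<close> are at most 1/2 in
  absolute value, so a geometric series of ratio 1/2 dominates. Hence all partial sums of the full
  series are at least 1/2.\<close>

lemma abs_tail_inv_sqrt_le:
  fixes y :: real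
  assumes "\<bar>y\<bar> \<le> 1/2"
  shows "\<bar>\<Sum>i=1..n. ((-1/2) gchoose i) * y ^ i\<bar> \<le> 1/2"
proof -
  have g: "\<bar>(-1/2::real) gchoose i\<bar> \<le> 1/2" if "i \<ge> 1" for i
    using that
  proof (induction i rule: dec_induct)
    case (step j)
    have "\<bar>(-1/2::real) gchoose Suc j\<bar> * real (Suc j) = \<bar>-1/2 - real j\<bar> * \<bar>(-1/2) gchoose j\<bar>"
      using arg_cong[OF gbinomial_Suc_mult[of "-1/2::real" j], of abs] by (simp add: abs_mult)
    also have "\<dots> \<le> real (Suc j) * (1/2)"
      using step by (intro mult_mono) auto
    finally show ?case by (simp del: of_nat_Suc add: mult.commute)
  qed auto
  have "\<bar>\<Sum>i=1..n. ((-1/2) gchoose i) * y ^ i\<bar> \<le> (\<Sum>i=1..n. \<bar>((-1/2) gchoose i) * y ^ i\<bar>)"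
    by (rule sum_abs)
  also have "\<dots> \<le> (\<Sum>i=1..n. (1/2) * (1/2) ^ i)"
    unfolding abs_mult power_abs
    using assms by (intro sum_mono mult_mono g power_mono) auto
  also have "\<dots> = (1/2) * (\<Sum>i=1..n. (1/2) ^ i)"
    by (simp add: sum_distrib_left)
  also have "(\<Sum>i=1..n. (1/2::real) ^ i) = 1 - (1/2) ^ n"
    by (induction n) (auto simp: field_simps)
  also have "(1/2) * (1 - (1/2::real) ^ n) \<le> 1/2" by simp
  finally show ?thesis .
qed

text \<open>The sum is the coefficient of \<open>t ^ r\<close> in
  \<open>(1 + y t) powr (m - 1/2) / (1 - t) ^ (m + 1)
   = ((1 + y t) / (1 - t)) ^ m * ((1 + y t) powr (-1/2) / (1 - t))\<close>,
  where the first factor has nonnegative coefficients and constant term 1, and all coefficients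
  of the second are at least 1/2.\<close>
lemma pade_denominator_ge_half:
  fixes y :: real
  assumes "\<bar>y\<bar> \<le> 1/2"
  shows "(\<Sum>j\<le>r. ((real m - 1/2) gchoose j) * real ((m + r - j) choose m) * y ^ j) \<ge> 1/2"
proof -
  define A where "A = fps_binom_scaled 1 y * fps_binom_scaled (-1) (-1)"
  define H where "H = fps_binom_scaled (-1/2) y * fps_binom_scaled (-1) (-1)"
  \<comment> \<open>\<open>fps_binom_scaled (-1) (-1)\<close> is \<open>1 / (1 - t)\<close>, so the
    coefficients of \<open>A\<close> and \<open>H\<close> are partial sums: those of
    \<open>1 + y t\<close>, hence 1 or \<open>1 + y\<close>, and those of
    \<open>(1 + y t) powr (-1/2)\<close>.\<close>
  have neg1: "((-1::real) gchoose n) * (-1) ^ n = 1" for n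
    using gbinomial_minus_Suc[of 0 n] by simp
  have H: "fps_nth H n \<ge> 1/2" for n
  proof -
    have "fps_nth H n = (\<Sum>i=0..n. ((-1/2) gchoose i) * y ^ i)"
      by (simp add: H_def fps_binom_scaled_def fps_mult_nth neg1)
    also have "\<dots> = 1 + (\<Sum>i=1..n. ((-1/2) gchoose i) * y ^ i)"
      by (simp add: sum.atLeast_Suc_atMost)
    finally show ?thesis using abs_tail_inv_sqrt_le[OF assms, of n] by linarith
  qed
  have A: "fps_nth A n \<ge> 0" for n
  proof -
    have "fps_nth A n = (\<Sum>i=0..n. (1 gchoose i) * y ^ i)"
      by (simp add: A_def fps_binom_scaled_def fps_mult_nth neg1)
    also have "\<dots> = (\<Sum>i\<in>{0..n} \<inter> {0,1}. (1 gchoose i) * y ^ i)"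
    proof (rule sum.mono_neutral_right)
      show "\<forall>i\<in>{0..n} - {0..n} \<inter> {0, 1}. (1 gchoose i) * y ^ i = 0"
      proof
        fix i assume "i \<in> {0..n} - {0..n} \<inter> {0, 1}"
        then have "1 < i" by auto
        then have "(1::real) gchoose i = 0"
          using binomial_gbinomial[of 1 i, where 'a = real, symmetric] by (simp add: binomial_eq_0)
        then show "(1 gchoose i) * y ^ i = 0" by simp
      qed
    qed auto
    also have "\<dots> \<ge> 0"
    proof (cases "n = 0")
      case False
      then have "{0..n} \<inter> {0,1} = {0,1}" by auto
      then show ?thesis using assms by auto
    qed auto
    finally show ?thesis .
  qed
  have A0: "fps_nth A 0 = 1"
    by (simp add: A_def fps_binom_scaled_def)
  \<comment> \<open>Only the term of index 0 of the convolution is kept; all others are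
    nonnegative.\<close>
  have "1/2 \<le> fps_nth (A ^ m) 0 * fps_nth H (r - 0)"
    using H[of r] A0 by (simp add: fps_nth_power_0)
  also have "\<dots> \<le> fps_nth (A ^ m * H) r"
    unfolding fps_mult_nth
    using A H by (intro member_le_sum) (auto intro!: mult_nonneg_nonneg fps_nonneg_power intro: order_trans[of 0 "1/2"])
  also have "A ^ m * H = fps_binom_scaled (real m - 1/2) y * fps_binom_scaled (-(real m + 1)) (-1)"
  proof -
    have "A ^ m * H = (fps_binom_scaled (real m * 1) y * fps_binom_scaled (-1/2) y) *
        (fps_binom_scaled (real m * (-1)) (-1) * fps_binom_scaled (-1) (-1))"
      by (simp only: A_def H_def power_mult_distrib fps_binom_scaled_power mult_ac)
    then show ?thesis by (simp add: fps_binom_scaled_mult)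
  qed
  also have "fps_nth \<dots> r =
      (\<Sum>j=0..r. ((real m - 1/2) gchoose j) * y ^ j * real ((m + (r - j)) choose m))"
    by (simp only: fps_mult_nth fps_binom_scaled_def fps_nth_Abs_fps gbinomial_minus_Suc)
  also have "\<dots> = (\<Sum>j\<le>r. ((real m - 1/2) gchoose j) * real ((m + r - j) choose m) * y ^ j)"
    by (rule sum.cong) (auto simp: mult_ac)
  finally show ?thesis .
qed

text \<open>The Pade approximant of type (m, 2m) to \<open>sqrt (1 + y)\<close> at 0. The numerator is the
  truncation at degree m of the series of \<open>sqrt (1 + y) * pade_Q m y\<close>, whose coefficients of
  index between m + 1 and 3m vanish. The asymmetric type is essential: diagonal approximants give
  irrationality exponents slightly above 2, which is not enough here.\<close>
definition pade_Q :: "nat \<Rightarrow> real \<Rightarrow> real" where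
  "pade_Q m y = (\<Sum>j\<le>2*m. ((real m - 1/2) gchoose j) * real ((3 * m - j) choose m) * y ^ j)"

definition pade_P :: "nat \<Rightarrow> real \<Rightarrow> real" where
  "pade_P m y = (\<Sum>i\<le>m. (\<Sum>j\<le>i. ((real m - 1/2) gchoose j) * real ((3 * m - j) choose m) *
      ((1/2) gchoose (i - j))) * y ^ i)"

lemma pade_Q_ge_half: "\<bar>y\<bar> \<le> 1/2 \<Longrightarrow> pade_Q m y \<ge> 1/2"
  using pade_denominator_ge_half[of y m "2 * m"] by (simp add: pade_Q_def)

lemma abs_pade_coeff_le:
  "\<bar>((real m - 1/2) gchoose j) * real ((3 * m - j) choose m)\<bar> \<le> 2 ^ (4 * m + j)"
proof -
  have "real ((3 * m - j) choose m) \<le> real (2 ^ (3 * m - j))"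
    by (intro of_nat_mono binomial_le_pow2)
  also have "\<dots> \<le> 2 ^ (3 * m)" by simp
  finally have "\<bar>(real m - 1/2) gchoose j\<bar> * real ((3 * m - j) choose m) \<le> 2 ^ (m + j) * 2 ^ (3 * m)"
    by (intro mult_mono abs_gbinomial_half_le) auto
  also have "\<dots> = 2 ^ (4 * m + j)" by (simp flip: power_add)
  finally show ?thesis by (simp add: abs_mult)
qed

lemma pade_Q_le:
  assumes "\<bar>y\<bar> \<le> 1/4"
  shows "pade_Q m y \<le> 2 ^ (4 * m + 1)"
proof -
  have "pade_Q m y \<le> (\<Sum>j\<le>2*m. 2 ^ (4 * m) * (1/2) ^ j)"
    unfolding pade_Q_def
  proof (rule sum_mono)
    fix j
    have "((real m - 1/2) gchoose j) * real ((3 * m - j) choose m) * y ^ j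
      \<le> \<bar>((real m - 1/2) gchoose j) * real ((3 * m - j) choose m)\<bar> * \<bar>y\<bar> ^ j"
      by (metis abs_ge_self abs_mult power_abs)
    also have "\<dots> \<le> 2 ^ (4 * m + j) * (1/4) ^ j"
      using assms by (intro mult_mono abs_pade_coeff_le power_mono) auto
    also have "\<dots> = 2 ^ (4 * m) * (1/2) ^ j"
      by (simp add: power_add mult.assoc flip: power_mult_distrib)
    finally show "((real m - 1/2) gchoose j) * real ((3 * m - j) choose m) * y ^ j
      \<le> 2 ^ (4 * m) * (1/2) ^ j" .
  qed
  also have "\<dots> = 2 ^ (4 * m) * (\<Sum>j\<le>2*m. (1/2) ^ j)"
    by (simp add: sum_distrib_left)
  also have "(\<Sum>j\<le>n. (1/2::real) ^ j) \<le> 2" for n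
  proof -
    have "(\<Sum>j\<le>n. (1/2::real) ^ j) = 2 - (1/2) ^ n"
      by (induction n) (auto simp: field_simps)
    then show ?thesis by simp
  qed
  finally show ?thesis by simp
qed

text \<open>The error is, up to sign, the tail from index \<open>3 * m + 1\<close> of the Cauchy
  product of \<open>pade_Q\<close> with the binomial series of the square root; its coefficients are
  uniformly bounded, so a geometric series estimates it.\<close>

lemma pade_remainder:
  assumes "m \<ge> 1" "\<bar>y\<bar> \<le> 1/4"
  shows "\<bar>pade_P m y - sqrt (1 + y) * pade_Q m y\<bar> \<le> 2 ^ (6 * m + 2) * \<bar>y\<bar> ^ (3 * m + 1)"
proof -
  define q where "q j = ((real m - 1/2) gchoose j) * real ((3 * m - j) choose m)" for j
  define c where "c i = (\<Sum>j\<le>i. q j * ((1/2) gchoose (i - j)))" for i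
  \<comment> \<open>For \<open>j \<ge> 3 * m\<close> the truncated difference is 0, and
    \<open>0 choose m\<close> vanishes only because \<open>m \<ge> 1\<close>.\<close>
  have q0: "q j = 0" if "j > 2 * m" for j
    using that assms by (simp add: q_def binomial_eq_0)
  have c0: "c i = 0" if "m < i" "i \<le> 3 * m" for i
    unfolding c_def q_def using pade_coeff_vanish[of "real m - 1/2" "1/2" m i "3 * m"] that by simp
  have cb: "\<bar>c i\<bar> \<le> 2 ^ (6 * m + 1)" for i
  proof -
    have "\<bar>c i\<bar> \<le> (\<Sum>j\<le>i. \<bar>q j\<bar> * \<bar>(1/2) gchoose (i - j)\<bar>)"
      unfolding c_def abs_mult[symmetric] by (rule sum_abs)
    also have "\<dots> \<le> (\<Sum>j\<le>i. \<bar>q j\<bar> * 1)"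
      by (intro sum_mono mult_left_mono abs_gbinomial_le_1) auto
    also have "\<dots> = (\<Sum>j\<in>{..i} \<inter> {..2*m}. \<bar>q j\<bar>)"
      unfolding mult_1_right
    proof (rule sum.mono_neutral_right)
      show "\<forall>j\<in>{..i} - {..i} \<inter> {..2*m}. \<bar>q j\<bar> = 0"
        using q0 by (metis DiffE IntI abs_zero atMost_iff not_le)
    qed auto
    also have "\<dots> \<le> (\<Sum>j\<le>2*m. \<bar>q j\<bar>)"
      by (intro sum_mono2) auto
    also have "\<dots> \<le> (\<Sum>j\<le>2*m. 2 ^ (4 * m) * 2 ^ j)"
      unfolding q_def power_add[symmetric] by (intro sum_mono abs_pade_coeff_le)
    also have "\<dots> = 2 ^ (4 * m) * (\<Sum>j\<le>2*m. 2 ^ j)"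
      by (simp add: sum_distrib_left)
    also have "(\<Sum>j\<le>n. 2 ^ j) \<le> (2::real) ^ (n + 1)" for n
    proof -
      have "(\<Sum>j\<le>n. 2 ^ j) = (2::real) ^ (n + 1) - 1"
        by (induction n) auto
      then show ?thesis by simp
    qed
    also have "2 ^ (4 * m) * 2 ^ (2 * m + 1) = (2::real) ^ (6 * m + 1)"
      by (simp flip: power_add)
    finally show ?thesis by simp
  qed
  have y1: "\<bar>y\<bar> < 1" using assms by simp
  have sq: "(\<lambda>i. ((1/2) gchoose i) * y ^ i) sums sqrt (1 + y)"
    using gen_binomial_real[OF y1, of "1/2"] assms by (simp add: powr_half_sqrt)
  have sqa: "summable (\<lambda>i. norm (((1/2) gchoose i) * y ^ i))"
  proof (rule summable_comparison_test)
    show "\<exists>N. \<forall>n\<ge>N. norm (norm ((1/2 gchoose n) * y ^ n)) \<le> \<bar>y\<bar> ^ n"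
      using abs_gbinomial_le_1[of "1/2"]
      by (auto simp: abs_mult power_abs intro!: mult_left_le_one_le exI[of _ 0])
    show "summable (\<lambda>n. \<bar>y\<bar> ^ n)" using y1 by (simp add: summable_geometric)
  qed
  have Qs: "(\<lambda>j. q j * y ^ j) sums pade_Q m y"
    unfolding pade_Q_def q_def[symmetric] using q0 by (intro sums_finite) auto
  have Qa: "summable (\<lambda>j. norm (q j * y ^ j))"
    using q0 by (intro summable_finite[of "{..2*m}"]) auto
  have "(\<lambda>i. \<Sum>j\<le>i. (q j * y ^ j) * (((1/2) gchoose (i - j)) * y ^ (i - j)))
      sums (pade_Q m y * sqrt (1 + y))"
    using Cauchy_product_sums[OF Qa sqa] sums_unique[OF Qs] sums_unique[OF sq] by simp
  also have "(\<lambda>i. \<Sum>j\<le>i. (q j * y ^ j) * (((1/2) gchoose (i - j)) * y ^ (i - j))) = (\<lambda>i. c i * y ^ i)"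
    unfolding c_def sum_distrib_right
    by (intro ext sum.cong) (auto simp: mult_ac simp flip: power_add)
  finally have full: "(\<lambda>i. c i * y ^ i) sums (pade_Q m y * sqrt (1 + y))" .
  have "(\<lambda>i. c (i + (3 * m + 1)) * y ^ (i + (3 * m + 1))) sums
      (pade_Q m y * sqrt (1 + y) - (\<Sum>i<3*m+1. c i * y ^ i))"
    by (rule sums_split_initial_segment[OF full])
  moreover have "(\<Sum>i<3*m+1. c i * y ^ i) = pade_P m y"
    unfolding pade_P_def q_def[symmetric] c_def[symmetric]
    using c0 by (intro sum.mono_neutral_right) auto
  ultimately have tail: "(\<lambda>i. c (i + (3 * m + 1)) * y ^ (i + (3 * m + 1))) sums
      (pade_Q m y * sqrt (1 + y) - pade_P m y)" by simp
  have gs: "(\<lambda>i. 2 ^ (6 * m + 1) * \<bar>y\<bar> ^ (3 * m + 1) * \<bar>y\<bar> ^ i) sums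
      (2 ^ (6 * m + 1) * \<bar>y\<bar> ^ (3 * m + 1) * (1 / (1 - \<bar>y\<bar>)))"
    by (intro sums_mult geometric_sums) (use y1 in simp)
  have "norm (pade_Q m y * sqrt (1 + y) - pade_P m y) \<le> 
      2 ^ (6 * m + 1) * \<bar>y\<bar> ^ (3 * m + 1) * (1 / (1 - \<bar>y\<bar>))"
  proof (rule norm_sums_le[OF tail gs])
    fix i
    have "\<bar>c (i + (3 * m + 1))\<bar> * \<bar>y\<bar> ^ (i + (3 * m + 1))
        \<le> 2 ^ (6 * m + 1) * \<bar>y\<bar> ^ (i + (3 * m + 1))"
      by (intro mult_right_mono cb) auto
    then show "norm (c (i + (3 * m + 1)) * y ^ (i + (3 * m + 1)))
        \<le> 2 ^ (6 * m + 1) * \<bar>y\<bar> ^ (3 * m + 1) * \<bar>y\<bar> ^ i"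
      by (simp add: abs_mult power_abs power_add mult_ac)
  qed
  also have "\<dots> \<le> 2 ^ (6 * m + 1) * \<bar>y\<bar> ^ (3 * m + 1) * 2"
    using assms by (intro mult_left_mono) (auto simp: field_simps)
  finally show ?thesis by (simp add: abs_minus_commute mult_ac)
qed

section \<open>The equation d w^2 = 2^n + k\<close>

lemma pade_Q_Ints:
  "4 ^ (2 * m) * 2 ^ (l * (2 * m)) * pade_Q m (of_int k / 2 ^ l) \<in> \<int>"
proof -
  have "4 ^ (2 * m) * 2 ^ (l * (2 * m)) * pade_Q m (of_int k / 2 ^ l)
      = (\<Sum>j\<le>2*m. (4 ^ j * ((real m - 1/2) gchoose j)) * real ((3 * m - j) choose m) *
          (of_int k ^ j * 4 ^ (2 * m - j) * 2 ^ (l * (2 * m - j))))"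
    unfolding pade_Q_def sum_distrib_left
  proof (intro sum.cong refl)
    fix j assume "j \<in> {..2*m}"
    then have "2 * m = j + (2 * m - j)" by simp
    then obtain e where e: "2 * m = j + e" and e': "2 * m - j = e" by blast
    show "4 ^ (2 * m) * 2 ^ (l * (2 * m)) * (((real m - 1/2) gchoose j) * real ((3 * m - j) choose m) *
        (of_int k / 2 ^ l) ^ j) = (4 ^ j * ((real m - 1/2) gchoose j)) * real ((3 * m - j) choose m) *
          (of_int k ^ j * 4 ^ (2 * m - j) * 2 ^ (l * (2 * m - j)))"
      unfolding e' unfolding e by (simp add: power_divide power_add power_mult distrib_left)
  qed
  also have "\<dots> \<in> \<int>"
    by (intro Ints_sum Ints_mult power4_gbinomial_half_Ints) auto
  finally show ?thesis .
qed

text \<open>Coefficient \<open>i\<close> needs only \<open>4 ^ i\<close>, split as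
  \<open>4 ^ j * 4 ^ (i - j)\<close> over the two half-integer binomials. As the degree is
  \<open>m\<close> instead of \<open>2 * m\<close>, the denominator bound is the square root of the
  one for \<open>pade_Q\<close>.\<close>

lemma pade_P_Ints:
  "4 ^ m * 2 ^ (l * m) * pade_P m (of_int k / 2 ^ l) \<in> \<int>"
proof -
  define c where "c i = (\<Sum>j\<le>i. ((real m - 1/2) gchoose j) * real ((3 * m - j) choose m) *
      ((1/2) gchoose (i - j)))" for i
  have c: "4 ^ i * c i \<in> \<int>" for i
  proof -
    have "4 ^ i * c i = (\<Sum>j\<le>i. (4 ^ j * ((real m - 1/2) gchoose j)) * real ((3 * m - j) choose m) *
      (4 ^ (i - j) * ((real 1 - 1/2) gchoose (i - j))))"
      unfolding c_def sum_distrib_left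
    proof (intro sum.cong refl)
      fix j assume "j \<in> {..i}"
      then have "(4::real) ^ i = 4 ^ j * 4 ^ (i - j)" by (simp flip: power_add)
      then show "4 ^ i * (((real m - 1/2) gchoose j) * real ((3 * m - j) choose m) * ((1/2) gchoose (i - j)))
        = (4 ^ j * ((real m - 1/2) gchoose j)) * real ((3 * m - j) choose m) *
          (4 ^ (i - j) * ((real 1 - 1/2) gchoose (i - j)))"
        by simp
    qed
    also have "\<dots> \<in> \<int>"
      by (intro Ints_sum Ints_mult power4_gbinomial_half_Ints) auto
    finally show ?thesis .
  qed
  have "4 ^ m * 2 ^ (l * m) * pade_P m (of_int k / 2 ^ l)
      = (\<Sum>i\<le>m. (4 ^ i * c i) * (of_int k ^ i * 4 ^ (m - i) * 2 ^ (l * (m - i))))"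
    unfolding pade_P_def c_def[symmetric] sum_distrib_left
  proof (intro sum.cong refl)
    fix i assume "i \<in> {..m}"
    then have "m = i + (m - i)" by simp
    then obtain e where e: "m = i + e" and e': "m - i = e" by blast
    show "4 ^ m * 2 ^ (l * m) * (c i * (of_int k / 2 ^ l) ^ i) =
      (4 ^ i * c i) * (of_int k ^ i * 4 ^ (m - i) * 2 ^ (l * (m - i)))"
      unfolding e' unfolding e by (simp add: power_divide power_add power_mult distrib_left)
  qed
  also have "\<dots> \<in> \<int>" by (intro Ints_sum Ints_mult c) auto
  finally show ?thesis .
qed

text \<open>With \<open>y = k / 2 ^ n0\<close> and \<open>n = n0 + 2 t\<close>, the quantity
  \<open>L = 4 ^ m * 2 ^ (n0 * m) * (P w - Q w0 2 ^ t)\<close> is an integer. It splits into an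
  approximation error and a term caused by \<open>w sqrt d \<noteq> 2 ^ (n/2)\<close>; for \<open>m\<close> close
  to \<open>2n / (5 n0)\<close> the second strictly dominates the first, while both are tiny, so that
  \<open>0 < \<bar>L\<bar> < 1\<close>.\<close>
lemma no_distant_solution:
  fixes d w w0 n n0 h :: nat and k :: int
  assumes "d \<ge> 1" "k \<noteq> 0" "\<bar>k\<bar> \<le> 2 ^ h" "d \<le> 2 ^ h"
    and eq0: "int d * int w0 ^ 2 = 2 ^ n0 + k"
    and eq: "int d * int w ^ 2 = 2 ^ n + k"
    and large: "n0 \<ge> 100 * (h + 10)" "n \<ge> 20 * n0" and parity: "even (n - n0)"
  shows False
proof -
  \<comment> \<open>The argument needs \<open>T = n0 * m\<close> below about \<open>n / 2\<close>
    for smallness and integrality, and above about \<open>n / 3\<close> for the Pade error to be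
    negligible. The ratio 2/5 lies in between, and \<open>n \<ge> 20 * n0\<close> makes the rounding
    to multiples of \<open>n0\<close> harmless.\<close>
  define m where "m = 2 * n div (5 * n0)"
  define T where "T = n0 * m"
  define t where "t = (n - n0) div 2"
  have t: "n = n0 + 2 * t" using parity large by (auto simp: t_def)
  have T1: "5 * T \<le> 2 * n"
    using div_times_less_eq_dividend[of "2 * n" "5 * n0"] by (simp add: m_def T_def mult_ac)
  have T2: "2 * n < 5 * T + 5 * n0"
    using dividend_less_div_times[of "5 * n0" "2 * n"] large by (simp add: m_def T_def mult_ac)
  have T3: "T \<ge> 100 * (h * m) + 1000 * m"
    using mult_right_mono[OF large(1), of m] by (simp add: T_def algebra_simps)
  then have T4: "T \<ge> 1000 * m" by simp
  have m1: "m \<ge> 1"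
    using T2 large by (cases "m = 0") (auto simp: T_def)
  \<comment> \<open>\<open>size1\<close> yields \<open>\<bar>L\<bar> < 1\<close>,
    \<open>size2\<close> the integrality of \<open>L\<close>, and \<open>size3\<close> that
    \<open>E\<close> is smaller than \<open>F\<close>.\<close>
  have size1: "2 * (6 * m + 3 + h + T) < n" using T1 T4 large by simp
  have size2: "2 * m + T \<le> t" using T1 T4 large t by linarith
  have size3: "n + 6 * m + 7 + (3 * (h * m) + 2 * h) < 3 * T + n0"
    using T1 T2 T3 T4 large by simp
  define y r a a0 S P Q u where "y = real_of_int k / 2 ^ n0" and "r = sqrt (real d)"
    and "a = sqrt (2 ^ n)" and "a0 = sqrt (2 ^ n0)" and "S = sqrt (1 + y)"
    and "P = pade_P m y" and "Q = pade_Q m y" and "u = real w * r - a"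
  have k1: "\<bar>real_of_int k\<bar> \<ge> 1" using \<open>k \<noteq> 0\<close> by linarith
  have kh: "\<bar>real_of_int k\<bar> \<le> 2 ^ h"
    using assms(3) by (metis of_int_abs of_int_le_iff of_int_numeral of_int_power)
  have y4: "\<bar>y\<bar> \<le> 1/4"
  proof -
    have "\<bar>real_of_int k\<bar> * 4 \<le> 2 ^ h * 2 ^ 2" using kh by simp
    also have "\<dots> \<le> 2 ^ n0" unfolding power_add[symmetric] using large by (intro power_increasing) auto
    finally show ?thesis by (simp add: y_def abs_mult field_simps)
  qed
  have pos: "r \<ge> 1" "a > 0" "a0 > 0" using assms(1) by (auto simp: r_def a_def a0_def)
  have r_le: "r \<le> 2 ^ h"
  proof -
    have "r \<le> real d" unfolding r_def using assms(1) by (intro real_le_lsqrt) (auto simp: power2_eq_square)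
    also have "\<dots> \<le> 2 ^ h" using assms(4) by (metis of_nat_le_iff of_nat_numeral of_nat_power)
    finally show ?thesis .
  qed
  have a2: "a ^ 2 = 2 ^ n" "a0 ^ 2 = 2 ^ n0" by (auto simp: a_def a0_def)
  have a: "a = a0 * 2 ^ t"
    unfolding a_def a0_def t by (simp add: power_add power_mult real_sqrt_mult real_sqrt_power)
  have r2: "r ^ 2 = real d" by (simp add: r_def)
  have e0: "(r * real w0) ^ 2 = 2 ^ n0 + of_int k"
    using arg_cong[OF eq0, of real_of_int] by (simp add: power_mult_distrib r2)
  have e1: "(r * real w) ^ 2 = 2 ^ n + of_int k"
    using arg_cong[OF eq, of real_of_int] by (simp add: power_mult_distrib r2)
  have S: "S = r * real w0 / a0"
  proof -
    have "(r * real w0 / a0) ^ 2 = 1 + y"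
      using e0 a2 by (simp add: power_divide y_def field_simps)
    then show ?thesis unfolding S_def using pos by (intro real_sqrt_unique) auto
  qed
  have S_bounds: "1/2 \<le> S" "S \<le> 2"
  proof -
    have "(1/2) ^ 2 \<le> 1 + y" "1 + y \<le> 2 ^ 2" using y4 by (simp_all add: power2_eq_square)
    then show "1/2 \<le> S" "S \<le> 2"
      unfolding S_def using real_le_rsqrt[of "1/2" "1 + y"] real_le_lsqrt[of 2 "1 + y"] by simp_all
  qed
  have wr: "r * real w \<le> 2 * a"
  proof (rule power2_le_imp_le)
    have "of_int k \<le> (2::real) ^ h" using kh by linarith
    also have "\<dots> \<le> 2 ^ n" using large by (intro power_increasing) auto
    finally have "of_int k \<le> (2::real) ^ n" .
    moreover have "(0::real) \<le> 2 ^ n" by simp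
    ultimately have "2 ^ n + of_int k \<le> 4 * (2::real) ^ n" by linarith
    moreover have "(2 * a) ^ 2 = 4 * (2::real) ^ n" by (simp add: power_mult_distrib a2)
    ultimately show "(r * real w) ^ 2 \<le> (2 * a) ^ 2" unfolding e1 by simp
  qed (use pos in auto)
  have w_le: "real w \<le> 2 * a"
    using wr mult_right_mono[OF pos(1), of "real w"] by simp
  \<comment> \<open>Multiplying \<open>u\<close> by its conjugate gives \<open>k\<close>; hence
    \<open>k \<noteq> 0\<close> bounds \<open>\<bar>u\<bar>\<close> away from 0, and
    \<open>\<bar>k\<bar> \<le> 2 ^ h\<close> bounds it above.\<close>
  have u: "\<bar>u\<bar> = \<bar>real_of_int k\<bar> / (r * real w + a)"
  proof -
    have "u * (r * real w + a) = (r * real w) ^ 2 - a ^ 2"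
      by (simp add: u_def power2_eq_square algebra_simps)
    also have "\<dots> = of_int k" by (simp add: e1 a2)
    finally have "\<bar>u\<bar> * \<bar>r * real w + a\<bar> = \<bar>real_of_int k\<bar>" by (metis abs_mult)
    moreover have "r * real w + a > 0" using pos by (intro add_nonneg_pos) auto
    ultimately show ?thesis by (simp add: field_simps)
  qed
  have u_lower: "1 / (3 * a) \<le> \<bar>u\<bar>"
    unfolding u using k1 wr pos by (intro frac_le) (auto intro: add_nonneg_pos)
  have u_upper: "\<bar>u\<bar> \<le> 2 ^ h / a"
    unfolding u using kh pos by (intro frac_le) auto
  have Q_lower: "Q \<ge> 1/2" unfolding Q_def using y4 by (intro pade_Q_ge_half) auto
  have Q_upper: "Q \<le> 2 ^ (4 * m + 1)" unfolding Q_def using y4 by (intro pade_Q_le)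
  \<comment> \<open>\<open>E\<close> carries the Pade error, \<open>F\<close> the gap
    \<open>u\<close> between \<open>w sqrt d\<close> and \<open>2 ^ (n/2)\<close>. They add up to
    the bracket in \<open>L\<close> because \<open>S = r * w0 / a0\<close> and
    \<open>a = a0 * 2 ^ t\<close>.\<close>
  define E F where "E = (P - S * Q) * real w" and "F = Q * real w0 * u / a0"
  have F: "\<bar>F\<bar> = Q * (S / r) * \<bar>u\<bar>"
    using pos Q_lower by (simp add: F_def S abs_mult)
  have F_upper: "\<bar>F\<bar> \<le> 2 ^ (4 * m + 1) * 2 * (2 ^ h / a)"
  proof -
    have "S / r \<le> 2 / 1" using S_bounds pos by (intro frac_le) auto
    then show ?thesis unfolding F using S_bounds pos Q_lower Q_upper u_upper
      by (intro mult_mono) auto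
  qed
  have F_lower: "\<bar>F\<bar> \<ge> 1 / (2 ^ (h + 4) * a)"
  proof -
    have "1 / (2 ^ (h + 4) * a) \<le> (1/2) * ((1/2) / 2 ^ h) * (1 / (3 * a))"
      using pos by (simp add: power_add field_simps)
    also have "\<dots> \<le> \<bar>F\<bar>"
      unfolding F using S_bounds pos r_le Q_lower u_lower
      by (intro mult_mono frac_le) auto
    finally show ?thesis .
  qed
  have E_upper: "\<bar>E\<bar> < 1 / (2 ^ (h + 4) * a)"
  proof -
    have "\<bar>E\<bar> \<le> (2 ^ (6 * m + 2) * \<bar>y\<bar> ^ (3 * m + 1)) * (2 * a)"
      unfolding E_def abs_mult P_def Q_def S_def
      using pade_remainder[OF m1 y4] w_le by (intro mult_mono) auto
    also have "\<dots> \<le> (2 ^ (6 * m + 2) * (2 ^ h / 2 ^ n0) ^ (3 * m + 1)) * (2 * a)"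
      using pos kh by (intro mult_right_mono mult_left_mono power_mono) (auto simp: y_def field_simps)
    also have "\<dots> = 2 ^ (6 * m + 3 + (3 * (h * m) + h)) * a / 2 ^ (3 * T + n0)"
    proof -
      have "(2 ^ h :: real) ^ (3 * m + 1) = 2 ^ (3 * (h * m) + h)"
        unfolding power_mult[symmetric] by (rule arg_cong[of _ _ "(^) 2"]) (simp add: algebra_simps)
      moreover have "(2 ^ n0 :: real) ^ (3 * m + 1) = 2 ^ (3 * T + n0)"
        unfolding power_mult[symmetric] by (rule arg_cong[of _ _ "(^) 2"]) (simp add: algebra_simps T_def)
      ultimately have eq: "(2 ^ h / 2 ^ n0 :: real) ^ (3 * m + 1) = 2 ^ (3 * (h * m) + h) / 2 ^ (3 * T + n0)"
        by (simp only: power_divide)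
      show ?thesis unfolding eq by (simp add: power_add mult_ac)
    qed
    also have "\<dots> < 1 / (2 ^ (h + 4) * a)"
    proof -
      have "2 ^ (6 * m + 3 + (3 * (h * m) + h)) * a * (2 ^ (h + 4) * a)
         = 2 ^ (6 * m + 3 + (3 * (h * m) + h) + (h + 4)) * a ^ 2"
        unfolding power_add[of _ _ "h + 4"] power2_eq_square by (simp only: mult_ac)
      also have "\<dots> = 2 ^ (6 * m + 3 + (3 * (h * m) + h) + (h + 4) + n)"
        by (simp add: a2 power_add)
      also have "\<dots> < 2 ^ (3 * T + n0)"
        using size3 by (intro power_strict_increasing) auto
      finally show ?thesis using pos by (simp add: field_simps)
    qed
    finally show ?thesis .
  qed
  define L where "L = 4 ^ m * 2 ^ T * (P * real w - Q * real w0 * 2 ^ t)"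
  have EF: "P * real w - Q * real w0 * 2 ^ t = E + F"
    unfolding E_def F_def S u_def a using pos by (simp add: field_simps)
  have "L \<in> \<int>"
  proof -
    \<comment> \<open>\<open>Q\<close> has the squared denominator of \<open>P\<close>; the surplus
      factor \<open>4 ^ m * 2 ^ T\<close> is taken out of \<open>2 ^ t\<close>.\<close>
    have "(2::real) ^ t = 2 ^ (2 * m) * 2 ^ T * 2 ^ (t - (2 * m + T))"
      using size2 by (simp flip: power_add)
    then have 1: "(2::real) ^ t = 4 ^ m * 2 ^ T * 2 ^ (t - (2 * m + T))"
      by (simp add: power_mult)
    have 2: "(4::real) ^ (2 * m) = 4 ^ m * 4 ^ m" "(2::real) ^ (n0 * (2 * m)) = 2 ^ T * 2 ^ T"
      by (auto simp: T_def algebra_simps simp flip: power_add)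
    have "L = (4 ^ m * 2 ^ (n0 * m) * P) * real w -
        (4 ^ (2 * m) * 2 ^ (n0 * (2 * m)) * Q) * (real w0 * 2 ^ (t - (2 * m + T)))"
      unfolding L_def 1 2 T_def[symmetric] by (simp add: algebra_simps)
    also have "\<dots> \<in> \<int>"
      unfolding P_def Q_def y_def by (intro Ints_diff Ints_mult pade_P_Ints pade_Q_Ints) auto
    finally show ?thesis .
  qed
  moreover have "L \<noteq> 0"
  proof -
    have "E + F \<noteq> 0" using E_upper F_lower by linarith
    then show ?thesis unfolding L_def EF by simp
  qed
  moreover have "\<bar>L\<bar> < 1"
  proof -
    have "\<bar>E + F\<bar> \<le> 2 * (2 ^ (4 * m + 1) * 2 * (2 ^ h / a))"
      using E_upper F_lower F_upper by linarith
    then have "\<bar>L\<bar> \<le> 4 ^ m * 2 ^ T * (2 * (2 ^ (4 * m + 1) * 2 * (2 ^ h / a)))"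
      unfolding L_def EF abs_mult by (intro mult_mono) auto
    also have "\<dots> = 2 ^ (6 * m + 3 + h + T) / a"
    proof -
      have "(4::real) ^ m = 2 ^ (2 * m)" by (simp add: power_mult)
      moreover have "6 * m + 3 + h + T = 2 * m + T + 1 + (4 * m + 1) + 1 + h" by simp
      ultimately show ?thesis by (simp only: power_add) simp
    qed
    also have "\<dots> < 1"
    proof -
      have "(2 ^ (6 * m + 3 + h + T)) ^ 2 < (2::real) ^ n"
        unfolding power_mult[symmetric] using size1 by (intro power_strict_increasing) auto
      then have "2 ^ (6 * m + 3 + h + T) < a"
        unfolding a_def by (rule real_less_rsqrt)
      then show ?thesis using pos by simp
    qed
    finally show ?thesis .
  qed
  ultimately show False by (auto elim!: Ints_cases)
qed

text \<open>An infinite set of exponents of one parity would contain a large \<open>n0\<close> and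
  some \<open>n \<ge> 20 * n0\<close>, against \<open>no_distant_solution\<close>.\<close>

lemma finite_ramanujan_nagell:
  fixes d :: nat and k :: int
  assumes "d \<ge> 1" "k \<noteq> 0"
  shows "finite {n. \<exists>w::nat. int d * int w ^ 2 = 2 ^ n + k}"
proof -
  define h where "h = d + nat \<bar>k\<bar>"
  have "d \<le> 2 ^ h"
    by (metis h_def less_exp less_imp_le le_trans le_add1)
  have "nat \<bar>k\<bar> \<le> 2 ^ h"
    by (metis h_def less_exp less_imp_le le_trans le_add2)
  then have kh: "\<bar>k\<bar> \<le> 2 ^ h"
    by (simp add: nat_le_iff)
  have "finite {n. (\<exists>w::nat. int d * int w ^ 2 = 2 ^ n + k) \<and> n mod 2 = p}" (is "finite ?A") for p
  proof (rule ccontr)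
    assume inf: "infinite ?A"
    then obtain n0 where n0: "n0 \<ge> 100 * (h + 10)" "n0 \<in> ?A"
      unfolding infinite_nat_iff_unbounded_le by blast
    obtain n where n: "n \<ge> 20 * n0" "n \<in> ?A"
      using inf unfolding infinite_nat_iff_unbounded_le by blast
    have "even (n - n0)"
      using n0 n by (auto simp: mod_eq_dvd_iff_nat)
    then show False
      using n0 n no_distant_solution[OF assms kh \<open>d \<le> 2 ^ h\<close>] by blast
  qed
  then have "finite (\<Union>p\<in>{0,1}. {n. (\<exists>w::nat. int d * int w ^ 2 = 2 ^ n + k) \<and> n mod 2 = p})"
    by blast
  then show ?thesis
    by (rule rev_finite_subset) auto
qed

section \<open>Perfect numbers\<close>

lemma divisor_sum_coprime_mult:
  assumes "coprime a b" "a > 0" "b > 0"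
  shows "divisor_sum (a * b) = divisor_sum a * divisor_sum b"
proof -
  have "bij_betw (\<lambda>(x, y). x * y) ({d. d dvd a} \<times> {d. d dvd b}) {d. d dvd a * b}"
  proof (rule bij_betw_imageI)
    show "inj_on (\<lambda>(x, y). x * y) ({d. d dvd a} \<times> {d. d dvd b})"
    proof (rule inj_onI, clarify)
      fix x y x' y' assume *: "x dvd a" "y dvd b" "x' dvd a" "y' dvd b" "x * y = x' * y'"
      have cop: "coprime u v" if "u dvd a" "v dvd b" for u v
        using assms(1) that coprime_divisors by blast
      have "x dvd x'" "x' dvd x"
        using * cop by (metis coprime_dvd_mult_left_iff dvd_triv_left)+
      then have "x = x'" by (rule dvd_antisym)
      moreover have "x > 0" using * assms by (auto intro: Nat.gr0I)
      ultimately show "x = x' \<and> y = y'" using * by simp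
    qed
    show "(\<lambda>(x, y). x * y) ` ({d. d dvd a} \<times> {d. d dvd b}) = {d. d dvd a * b}"
    proof (intro equalityI subsetI)
      fix d assume "d \<in> {d. d dvd a * b}"
      then obtain u v where "d = u * v" "u dvd a" "v dvd b"
        by (auto elim!: dvd_productE)
      then show "d \<in> (\<lambda>(x, y). x * y) ` ({d. d dvd a} \<times> {d. d dvd b})" by force
    qed (auto intro: mult_dvd_mono)
  qed
  from sum.reindex_bij_betw[OF this, of "\<lambda>d. d"]
  have "divisor_sum (a * b) = (\<Sum>(x, y)\<in>{d. d dvd a} \<times> {d. d dvd b}. x * y)"
    by (simp add: divisor_sum_def case_prod_beta)
  also have "\<dots> = divisor_sum a * divisor_sum b"
    by (simp add: divisor_sum_def sum_product sum.cartesian_product)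
  finally show ?thesis .
qed

text \<open>The involution \<open>d \<mapsto> n div d\<close> swaps the divisors below and above the
  square root. The pair sums give \<open>divisor_sum\<close> modulo 2 and modulo 4.\<close>

lemma divisor_sum_pairing:
  assumes "n > 0"
  shows "divisor_sum n = (\<Sum>d | d dvd n \<and> d * d < n. d + n div d) + (\<Sum>d | d * d = n. d)"
proof -
  have fin: "finite {d. d dvd n}" using assms by simp
  have split: "{d. d dvd n} = {d. d dvd n \<and> d * d < n} \<union> {d. d dvd n \<and> d * d > n} \<union> {d. d * d = n}"
    by auto
  have sq: "finite {d. d * d = n}"
    by (rule finite_subset[OF _ fin]) auto
  have bij: "bij_betw (\<lambda>d. n div d) {d. d dvd n \<and> d * d < n} {d. d dvd n \<and> d * d > n}"
  proof (rule bij_betwI[where g = "\<lambda>d. n div d"])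
    have flip: "(n div d) * (n div d) > n" if d: "d dvd n" "d * d < n" for d
    proof -
      obtain f where f: "n = d * f" using d(1) by blast
      then have "d < f" "d > 0" using d assms by (auto simp: mult_less_cancel1 intro: Nat.gr0I)
      then show ?thesis by (simp add: f)
    qed
    have flip': "(n div d) * (n div d) < n" if d: "d dvd n" "d * d > n" for d
    proof -
      obtain f where f: "n = d * f" using d(1) by blast
      then have "f < d" "f > 0" using d assms by (auto simp: mult_less_cancel1 intro: Nat.gr0I)
      then show ?thesis by (simp add: f)
    qed
    show "(\<lambda>d. n div d) \<in> {d. d dvd n \<and> d * d < n} \<rightarrow> {d. d dvd n \<and> d * d > n}"
      using flip by (auto simp: div_dvd_iff_mult)
    show "(\<lambda>d. n div d) \<in> {d. d dvd n \<and> d * d > n} \<rightarrow> {d. d dvd n \<and> d * d < n}"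
      using flip' by (auto simp: div_dvd_iff_mult)
  qed (use assms in \<open>auto elim!: dvdE\<close>)
  have "divisor_sum n = (\<Sum>d | d dvd n \<and> d * d < n. d) + (\<Sum>d | d dvd n \<and> d * d > n. d) + (\<Sum>d | d * d = n. d)"
    unfolding divisor_sum_def split using fin sq
    by (subst sum.union_disjoint; (subst sum.union_disjoint)?) auto
  also have "(\<Sum>d | d dvd n \<and> d * d > n. d) = (\<Sum>d | d dvd n \<and> d * d < n. n div d)"
    using sum.reindex_bij_betw[OF bij, of "\<lambda>d. d"] by simp
  finally show ?thesis by (simp add: sum.distrib)
qed

text \<open>Paired divisors of an odd number have even sum, so only an integral square root
  contributes to the parity.\<close>

lemma odd_divisor_sum_iff:
  assumes "odd n"
  shows "odd (divisor_sum n) \<longleftrightarrow> (\<exists>m. n = m ^ 2)"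
proof -
  have n: "n > 0" using assms by (auto intro: Nat.gr0I)
  have "even (\<Sum>d | d dvd n \<and> d * d < n. d + n div d)"
    using assms by (intro dvd_sum) (auto elim!: dvdE)
  then have iff: "odd (divisor_sum n) \<longleftrightarrow> odd (\<Sum>d | d * d = n. d)"
    unfolding divisor_sum_pairing[OF n] by simp
  show ?thesis
  proof (cases "\<exists>m. n = m ^ 2")
    case True
    then obtain m where m: "n = m * m" by (auto simp: power2_eq_square)
    then have "{d. d * d = n} = {m}" by (auto simp flip: power2_eq_square)
    then show ?thesis using iff True assms m by simp
  next
    case False
    then have "{d. d * d = n} = {}" by (auto simp: power2_eq_square)
    then show ?thesis using iff False by simp
  qed
qed

text \<open>A product that is 3 modulo 4 has one factor 1 and one factor 3, so each pair sum is
  divisible by 4; and 3 is not a square modulo 4.\<close>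

lemma four_dvd_divisor_sum:
  assumes "n mod 4 = 3"
  shows "4 dvd divisor_sum n"
proof -
  have n: "n > 0" using assms by (auto intro: Nat.gr0I)
  have "d * d mod 4 \<noteq> 3" for d :: nat
  proof -
    have "d mod 4 = 0 \<or> d mod 4 = 1 \<or> d mod 4 = 2 \<or> d mod 4 = 3" by presburger
    moreover have "d * d mod 4 = (d mod 4) * (d mod 4) mod 4" by (simp add: mod_mult_eq)
    ultimately show ?thesis by auto
  qed
  then have "{d. d * d = n} = {}" using assms by auto
  moreover have "4 dvd (\<Sum>d | d dvd n \<and> d * d < n. d + n div d)"
  proof (intro dvd_sum)
    fix d assume "d \<in> {d. d dvd n \<and> d * d < n}"
    then obtain f where f: "n = d * f" by blast
    then have "d > 0" using n by (auto intro: Nat.gr0I)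
    then have "n div d = f" by (simp add: f)
    have "d mod 4 = 0 \<or> d mod 4 = 1 \<or> d mod 4 = 2 \<or> d mod 4 = 3"
      "f mod 4 = 0 \<or> f mod 4 = 1 \<or> f mod 4 = 2 \<or> f mod 4 = 3" by presburger+
    moreover have "(d mod 4) * (f mod 4) mod 4 = 3" using assms by (simp add: f mod_mult_eq)
    ultimately have "((d mod 4) + (f mod 4)) mod 4 = 0" by auto
    then show "4 dvd d + n div d" unfolding \<open>n div d = f\<close> by (simp add: mod_add_eq mod_eq_0_iff_dvd)
  qed
  ultimately show ?thesis by (simp add: divisor_sum_pairing[OF n])
qed

text \<open>Strip a full prime power \<open>r ^ e\<close>. For even \<open>e\<close> its divisor sum
  is odd, and the hypotheses pass to the cofactor. For odd \<open>e\<close> it is even and uses up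
  the single factor 2, so the cofactor has odd divisor sum and is a square.\<close>

lemma odd_prime_times_square:
  assumes "odd n" "even (divisor_sum n)" "\<not> 4 dvd divisor_sum n"
  shows "\<exists>q m. prime q \<and> n = q * m ^ 2"
  using assms
proof (induction n rule: less_induct)
  case (less n)
  have n: "n > 0" using less by (auto intro: Nat.gr0I)
  have "n \<noteq> 1" using less by (auto simp: divisor_sum_def)
  then obtain r where r: "prime r" "r dvd n" using prime_factor_nat by blast
  define e where "e = multiplicity r n"
  have "\<not> is_unit r" using r(1) not_prime_unit by blast
  then obtain n' where n': "n = r ^ e * n'" "\<not> r dvd n'"
    unfolding e_def using multiplicity_decompose' n by blast
  have e: "e > 0" using r n by (simp add: e_def prime_multiplicity_gt_zero_iff)
  have "n' > 0" using n n' by (auto intro: Nat.gr0I)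
  have "r > 1" using r(1) prime_gt_1_nat by blast
  have "n' < n" using n' \<open>n' > 0\<close> one_less_power[OF \<open>r > 1\<close> e] by simp
  have odds: "odd (r ^ e)" "odd n'" using less.prems(1) n' by auto
  have cop: "coprime (r ^ e) n'" using r n' by (simp add: prime_imp_coprime)
  have mult: "divisor_sum n = divisor_sum (r ^ e) * divisor_sum n'"
    unfolding n'(1) using cop \<open>r > 1\<close> \<open>n' > 0\<close> by (intro divisor_sum_coprime_mult) auto
  show ?case
  proof (cases "even e")
    case True
    then have s: "r ^ e = (r ^ (e div 2)) ^ 2" by (simp flip: power_mult)
    then have "odd (divisor_sum (r ^ e))" using odd_divisor_sum_iff[OF odds(1)] by blast
    then have "even (divisor_sum n')" using less.prems mult by simp
    moreover have "\<not> 4 dvd divisor_sum n'" using less.prems mult by auto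
    ultimately obtain q m where "prime q" "n' = q * m ^ 2"
      using less.IH[OF \<open>n' < n\<close> odds(2)] by blast
    then have "n = q * (r ^ (e div 2) * m) ^ 2" using n' s by (simp add: power_mult_distrib)
    then show ?thesis using \<open>prime q\<close> by blast
  next
    case False
    have "even (divisor_sum (r ^ e))"
    proof (rule ccontr)
      assume "odd (divisor_sum (r ^ e))"
      then obtain m where m: "r ^ e = m ^ 2" using odd_divisor_sum_iff[OF odds(1)] by blast
      then have "m \<noteq> 0" using \<open>r > 1\<close> by (metis power_eq_0_iff not_one_less_zero zero_neq_numeral zero_power2)
      have "e = multiplicity r (m ^ 2)" unfolding m[symmetric] using r(1) by simp
      also have "\<dots> = 2 * multiplicity r m"
        using r(1) \<open>m \<noteq> 0\<close> by (simp add: prime_elem_multiplicity_power_distrib)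
      finally show False using False by simp
    qed
    then have "odd (divisor_sum n')" using less.prems mult by (auto simp: mult_dvd_mono elim!: evenE)
    then obtain m where "n' = m ^ 2" using odd_divisor_sum_iff[OF odds(2)] by blast
    moreover have "r ^ e = r * (r ^ (e div 2)) ^ 2"
      using False by (metis odd_two_times_div_two_succ power_Suc power_mult mult.commute Suc_eq_plus1)
    ultimately have "n = r * (r ^ (e div 2) * m) ^ 2" using n' by (simp add: power_mult_distrib)
    then show ?thesis using r by blast
  qed
qed

lemma odd_perfect_prime_times_square:
  assumes "perfect n" "odd n"
  shows "\<exists>q m. prime q \<and> n = q * m ^ 2"
proof (rule odd_prime_times_square[OF assms(2)])
  show "even (divisor_sum n)" "\<not> 4 dvd divisor_sum n"
    using assms unfolding perfect_def by presburger+
qed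

lemma odd_perfect_mod_4:
  assumes "perfect n" "odd n"
  shows "n mod 4 = 1"
proof (rule ccontr)
  assume "n mod 4 \<noteq> 1"
  then have "n mod 4 = 3" using assms(2) by presburger
  then have "4 dvd 2 * n" using four_dvd_divisor_sum[of n] assms(1) by (simp add: perfect_def)
  then show False using assms(2) by presburger
qed

lemma divisor_sum_power_2: "divisor_sum (2 ^ e) = 2 ^ Suc e - 1"
proof -
  have "{d::nat. d dvd 2 ^ e} = (\<lambda>i. 2 ^ i) ` {..e}"
    by (auto simp: divides_primepow_nat le_imp_power_dvd)
  then have "divisor_sum (2 ^ e) = (\<Sum>i\<le>e. 2 ^ i)"
    by (simp add: divisor_sum_def sum.reindex inj_on_def)
  also have "\<dots> = 2 ^ Suc e - 1" by (induction e) auto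
  finally show ?thesis .
qed

text \<open>With \<open>M = 2 ^ Suc e - 1\<close>, coprimality of \<open>M\<close> and
  \<open>M + 1\<close> gives \<open>u = M * t\<close> and \<open>divisor_sum u = u + t\<close>. For
  \<open>t \<noteq> 1\<close> the distinct divisors 1, \<open>t\<close>, \<open>u\<close> already
  exceed this.\<close>

lemma even_perfect_form:
  assumes "perfect x" "even x"
  shows "\<exists>e\<ge>1. x = 2 ^ e * (2 ^ Suc e - 1)"
proof -
  have x: "x > 0" "divisor_sum x = 2 * x" using assms by (auto simp: perfect_def)
  define e where "e = multiplicity 2 x"
  have "\<not> is_unit (2::nat)" by simp
  then obtain u where u: "x = 2 ^ e * u" "odd u"
    unfolding e_def using multiplicity_decompose'[of x 2] x(1) by blast
  have e: "e \<ge> 1" using u assms(2) by (cases e) auto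
  have "u > 0" using u by (auto intro: Nat.gr0I)
  define M where "M = (2::nat) ^ Suc e - 1"
  have M: "2 ^ Suc e = M + 1" by (simp add: M_def)
  have "(2::nat) ^ Suc e \<ge> 2 ^ 2" using e by (intro power_increasing) auto
  then have M3: "M \<ge> 3" by (simp add: M_def)
  have "divisor_sum x = divisor_sum (2 ^ e) * divisor_sum u"
    unfolding u(1) using u(2) \<open>u > 0\<close> by (intro divisor_sum_coprime_mult) auto
  then have eq: "M * divisor_sum u = (M + 1) * u"
    unfolding M[symmetric] using x u by (simp add: divisor_sum_power_2 M_def mult_ac)
  then have "M dvd (M + 1) * u" by (metis dvd_triv_left)
  then have "M dvd u" by (simp add: dvd_add_left_iff)
  then obtain t where t: "u = M * t" by blast
  then have "M * divisor_sum u = M * (u + t)" using eq by (simp add: algebra_simps)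
  then have ds: "divisor_sum u = u + t" using M3 by simp
  have "t = 1"
  proof (rule ccontr)
    assume "t \<noteq> 1"
    have "t > 0" using t \<open>u > 0\<close> by (auto intro: Nat.gr0I)
    moreover have "t < u" using t M3 \<open>t > 0\<close> by simp
    ultimately have "(\<Sum>d\<in>{1, t, u}. d) = 1 + t + u" using \<open>t \<noteq> 1\<close> by auto
    moreover have "(\<Sum>d\<in>{1, t, u}. d) \<le> divisor_sum u"
      unfolding divisor_sum_def using \<open>u > 0\<close> t by (intro sum_mono2) auto
    ultimately show False using ds by simp
  qed
  then show ?thesis using e u t by (auto simp: M_def)
qed

section \<open>Reduction to finitely many exponential equations\<close>

text \<open>A prime of odd multiplicity in \<open>U\<close> differs from \<open>q\<close>, so its
  multiplicity in \<open>V\<close> is odd as well and it divides both numbers.\<close>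

lemma squarefree_part_dvd_gcd:
  fixes U V q :: nat
  assumes "U > 0" "V > 0" "even (multiplicity q U)"
    and "\<And>r. prime r \<Longrightarrow> r \<noteq> q \<Longrightarrow> even (multiplicity r U + multiplicity r V)"
  shows "squarefree_part U dvd gcd U V"
proof (rule multiplicity_le_imp_dvd)
  fix r :: nat assume r: "prime r"
  show "multiplicity r (squarefree_part U) \<le> multiplicity r (gcd U V)"
  proof (cases "even (multiplicity r U)")
    case True
    then show ?thesis using r by (simp add: prime_multiplicity_squarefree_part)
  next
    case False
    then have "r \<noteq> q" using assms(3) by auto
    then have "odd (multiplicity r V)" using False assms(4)[OF r] by simp
    then have "r dvd U" "r dvd V" using False by (auto intro: ccontr simp: not_dvd_imp_multiplicity_0)
    then have "multiplicity r (gcd U V) > 0"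
      using r assms(1) by (simp add: prime_multiplicity_gt_zero_iff)
    then show ?thesis using r False by (simp add: prime_multiplicity_squarefree_part)
  qed
qed (use assms(1) in auto)

text \<open>The multiplicity of \<open>q\<close> in \<open>U * V\<close> is odd, hence even in
  exactly one factor; the squarefree part of that factor divides the gcd.\<close>

lemma factor_of_prime_times_square:
  fixes U V q m :: nat
  assumes "prime q" "U * V = q * m ^ 2" "U * V > 0"
  shows "squarefree_part U dvd gcd U V \<or> squarefree_part V dvd gcd U V"
proof -
  have pos: "U > 0" "V > 0" "m > 0" using assms by (auto intro: Nat.gr0I)
  have sum: "multiplicity r U + multiplicity r V = multiplicity r q + 2 * multiplicity r m"
    if "prime r" for r
  proof -
    have "multiplicity r (U * V) = multiplicity r U + multiplicity r V"
      using pos that by (intro prime_elem_multiplicity_mult_distrib) auto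
    moreover have "multiplicity r (q * m ^ 2) = multiplicity r q + multiplicity r (m ^ 2)"
      using pos that assms(1) by (intro prime_elem_multiplicity_mult_distrib) auto
    moreover have "multiplicity r (m ^ 2) = 2 * multiplicity r m"
      using pos that by (simp add: prime_elem_multiplicity_power_distrib)
    ultimately show ?thesis using assms(2) by simp
  qed
  have ev: "even (multiplicity r U + multiplicity r V)" if "prime r" "r \<noteq> q" for r
    using sum[OF that(1)] that assms(1) by (simp add: prime_multiplicity_other)
  have "odd (multiplicity q U + multiplicity q V)"
    using sum[OF assms(1)] assms(1) by simp
  then consider "even (multiplicity q U)" | "even (multiplicity q V)" by auto
  then show ?thesis
  proof cases
    case 1
    then show ?thesis using squarefree_part_dvd_gcd[OF pos(1,2)] ev by blast
  next
    case 2
    then show ?thesis using squarefree_part_dvd_gcd[OF pos(2,1)] ev by (simp add: add.commute gcd.commute)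
  qed
qed

lemma finite_exponents:
  fixes c :: int
  assumes "c \<noteq> 0"
  shows "finite {e. \<exists>d w::nat. d dvd nat \<bar>4 * c - 1\<bar> \<and>
    (int d * int w ^ 2 = 2 ^ e - c \<or> int d * int w ^ 2 = 2 ^ Suc e + (2 * c - 1))}" (is "finite ?E")
proof -
  let ?A = "\<lambda>d. {e. \<exists>w::nat. int d * int w ^ 2 = 2 ^ e + (-c)}"
  let ?B = "\<lambda>d. {n. \<exists>w::nat. int d * int w ^ 2 = 2 ^ n + (2 * c - 1)}"
  define D where "D = nat \<bar>4 * c - 1\<bar>"
  have D: "D > 0" by (simp add: D_def) presburger
  have "2 * c - 1 \<noteq> 0" by presburger
  \<comment> \<open>The preimage under \<open>Suc\<close> appears since the second equation has
    exponent \<open>Suc e\<close>.\<close>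
  have "finite (?A d \<union> Suc -` ?B d)" if "d dvd D" for d
  proof -
    have "d \<ge> 1" using D that by (auto simp: Suc_le_eq intro: Nat.gr0I)
    then have "finite (?A d)" "finite (?B d)"
      using finite_ramanujan_nagell[of d "-c"] finite_ramanujan_nagell[OF _ \<open>2 * c - 1 \<noteq> 0\<close>] assms
      by simp_all
    then show ?thesis by (intro finite_UnI finite_vimageI inj_Suc)
  qed
  then have "finite (\<Union>d\<in>{d. d dvd D}. ?A d \<union> Suc -` ?B d)"
    using D by (intro finite_UN_I) auto
  then show ?thesis
    by (rule rev_finite_subset) (auto simp: D_def)
qed

lemma exponent_of_solution:
  fixes c :: int and e y q m :: nat
  assumes "prime q" "y = q * m ^ 2" "y > 0"
    and y: "int y = 2 ^ e * (2 ^ Suc e - 1) - c * (2 * c - 1)"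
  shows "\<exists>d w::nat. d dvd nat \<bar>4 * c - 1\<bar> \<and>
    (int d * int w ^ 2 = 2 ^ e - c \<or> int d * int w ^ 2 = 2 ^ Suc e + (2 * c - 1))"
proof -
  define u v where "u = 2 ^ e - c" and "v = 2 ^ Suc e + (2 * c - 1)"
  have uv: "u * v = int y" unfolding y u_def v_def by (simp add: algebra_simps)
  \<comment> \<open>Since \<open>u * v > 0\<close>, the factors have the same sign; positivity of
    this combination excludes both being negative.\<close>
  have "2 * u + v = 4 * 2 ^ e - 1" by (simp add: u_def v_def)
  moreover have "(1::int) \<le> 2 ^ e" by simp
  ultimately have "2 * u + v > 0" by linarith
  moreover have "u * v > 0" using uv assms(3) by simp
  ultimately have pos: "u > 0" "v > 0" by (auto simp: zero_less_mult_iff)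
  define U V where "U = nat u" and "V = nat v"
  have UV: "int U = u" "int V = v" using pos by (auto simp: U_def V_def)
  have "int (U * V) = int y" using uv UV by simp
  then have prod: "U * V = q * m ^ 2" "U * V > 0" using assms(2,3) by (simp_all only: of_nat_eq_iff)
  have "int (gcd U V) dvd v - 2 * u"
    unfolding UV[symmetric] by (intro dvd_diff dvd_mult) auto
  then have "int (gcd U V) dvd 4 * c - 1" by (simp add: u_def v_def)
  then have g: "gcd U V dvd nat \<bar>4 * c - 1\<bar>" by (simp only: nat_abs_dvd_iff dvd_nat_abs_iff)
  have decompose: "int (squarefree_part n) * int (square_part n) ^ 2 = int n" for n :: nat
    using arg_cong[OF squarefree_decompose[of n, symmetric], of int] by simp
  have sq: "int (squarefree_part U) * int (square_part U) ^ 2 = 2 ^ e - c"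
    "int (squarefree_part V) * int (square_part V) ^ 2 = 2 ^ Suc e + (2 * c - 1)"
    unfolding decompose UV u_def v_def by simp_all
  from factor_of_prime_times_square[OF assms(1) prod] show ?thesis
    using sq g dvd_trans by meson
qed

theorem theorem1p3:
  fixes b \<delta> :: nat
  assumes "b > 0"
    and "\<delta> = b * (b - 1) div 2"
    and "[\<delta> = 3] (mod 4)"
  shows "finite {(x, y). perfect x \<and> perfect y \<and> int x - int y = int \<delta>}"
proof -
  have mod4: "\<delta> mod 4 = 3" using assms(3) by (simp add: cong_def)
  \<comment> \<open>A signed \<open>c\<close> treats both parities of \<open>b\<close> at once:
    \<open>c = k\<close> for \<open>b = 2 * k\<close> and \<open>c = -k\<close> for
    \<open>b = 2 * k + 1\<close>.\<close>
  obtain c :: int where c: "int \<delta> = c * (2 * c - 1)"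
  proof (cases "even b")
    case True
    then obtain k where k: "b = 2 * k" by blast
    then have "int \<delta> = int k * (2 * int k - 1)" using assms(1,2) by (simp add: of_nat_diff)
    then show ?thesis by (rule that)
  next
    case False
    then obtain k where k: "b = 2 * k + 1" by (blast elim: oddE)
    then have "int \<delta> = (- int k) * (2 * (- int k) - 1)" using assms(2) by (simp add: algebra_simps)
    then show ?thesis by (rule that)
  qed
  have "c \<noteq> 0" using c mod4 by auto
  define E where "E = {e. \<exists>d w::nat. d dvd nat \<bar>4 * c - 1\<bar> \<and>
    (int d * int w ^ 2 = 2 ^ e - c \<or> int d * int w ^ 2 = 2 ^ Suc e + (2 * c - 1))}"
  have "finite E" unfolding E_def by (rule finite_exponents[OF \<open>c \<noteq> 0\<close>])
  let ?x = "\<lambda>e. 2 ^ e * (2 ^ Suc e - 1) :: nat"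
  have "(x, y) \<in> insert (\<delta> + 6, 6) ((\<lambda>e. (?x e, ?x e - \<delta>)) ` E)"
    if x: "perfect x" and y: "perfect y" and diff: "int x - int y = int \<delta>" for x y
  proof -
    have xy: "x = y + \<delta>" using diff by simp
    show ?thesis
    proof (cases "even y")
      case True
      then obtain e where e: "e \<ge> 1" "y = ?x e" using even_perfect_form[OF y] by blast
      have "odd x" using xy True mod4 by presburger
      then have "x mod 4 = 1" by (rule odd_perfect_mod_4[OF x])
      \<comment> \<open>Since \<open>y\<close> is divisible by 2 but not by 4, its exponent
        \<open>e\<close> is 1, which gives the exceptional pair with \<open>y = 6\<close>.\<close>
      then have "y mod 4 = 2" unfolding xy using mod4 by presburger
      have "e = 1"
      proof (rule ccontr)
        assume "e \<noteq> 1"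
        then have "(2::nat) ^ 2 dvd 2 ^ e" using e(1) by (intro le_imp_power_dvd) auto
        then have "4 dvd y" unfolding e(2) by auto
        then show False using \<open>y mod 4 = 2\<close> by presburger
      qed
      then show ?thesis using e(2) xy by simp
    next
      case False
      then have "even x" using xy mod4 by presburger
      then obtain e where e: "x = ?x e" using even_perfect_form[OF x] by blast
      obtain q m where "prime q" "y = q * m ^ 2"
        using odd_perfect_prime_times_square[OF y False] by blast
      moreover have "y > 0" using y by (simp add: perfect_def)
      moreover have "int y = 2 ^ e * (2 ^ Suc e - 1) - c * (2 * c - 1)"
        using diff c unfolding e by (simp add: of_nat_diff)
      ultimately have "e \<in> E" unfolding E_def using exponent_of_solution by blast
      then show ?thesis using e xy by (intro insertI2 image_eqI[of _ _ e]) auto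
    qed
  qed
  then show ?thesis
    by (intro finite_subset[OF _ finite.insertI[OF finite_imageI[OF \<open>finite E\<close>]]]) auto
qed

end
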